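(* Let $p$ be an odd prime with $p\neq 5$, and let $B$ be a non-empty subset of $\mathbb Z_p$. Then $E_{Q_p,B}=p+2$.
   Context: For an odd prime $p$, $\mathbb Z_p=\mathbb Z/p\mathbb Z$, $U(p)$ is its group of units, and $Q_p=\{x^2:x\in U(p)\}$. A sequence of length $k$ in $\mathbb Z_p$ is an element of $\mathbb Z_p^k$. For a non-empty $B\subseteq\mathbb Z_p$, a sequence $(x_1,\ldots,x_k)$ in $\mathbb Z_p$ is called a $(Q_p,B)$-weighted zero-sum sequence if there exist $a_1,\ldots,a_k\in Q_p$ and $b_1,\ldots,b_k\in B$ such that $a_1x_1+\cdots+a_kx_k=0$ and $b_1a_1+\cdots+b_ka_k=0$ in $\mathbb Z_p$. The constant $E_{Q_p,B}$ is the least positive integer $k$ such that every sequence in $\mathbb Z_p$ of length $k$ has a $(Q_p,B)$-weighted zero-sum subsequence of length $p$ (terms not necessarily consecutive). *)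

theory Defs
  imports "HOL-Number_Theory.Residues" "HOL-Library.Sublist"
begin

abbreviation Zmod :: "nat \<Rightarrow> int ring" where
  "Zmod p \<equiv> residue_ring (int p)"

definition unit_squares :: "nat \<Rightarrow> int set" where
  "unit_squares p = {x [^]\<^bsub>Zmod p\<^esub> (2::nat) | x. x \<in> Units (Zmod p)}"

definition weighted_zero_sum :: "nat \<Rightarrow> int set \<Rightarrow> int set \<Rightarrow> int list \<Rightarrow> bool" where
  "weighted_zero_sum p A B xs \<longleftrightarrow>
     (\<exists>as bs. length as = length xs \<and> set as \<subseteq> A \<and>
              length bs = length xs \<and> set bs \<subseteq> B \<and>
              (\<Oplus>\<^bsub>Zmod p\<^esub> i \<in> {..<length xs}. as ! i \<otimes>\<^bsub>Zmod p\<^esub> xs ! i) = \<zero>\<^bsub>Zmod p\<^esub> \<and>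
              (\<Oplus>\<^bsub>Zmod p\<^esub> i \<in> {..<length xs}. bs ! i \<otimes>\<^bsub>Zmod p\<^esub> as ! i) = \<zero>\<^bsub>Zmod p\<^esub>)"

(* The subsequences have length p, the modulus. LEAST is unspecified if no such k exists. *)
definition E_const :: "nat \<Rightarrow> int set \<Rightarrow> int set \<Rightarrow> nat" where
  "E_const p A B = (LEAST k. 0 < k \<and>
     (\<forall>xs. set xs \<subseteq> carrier (Zmod p) \<and> length xs = k \<longrightarrow>
        (\<exists>ys. subseq ys xs \<and> length ys = p \<and> weighted_zero_sum p A B ys)))"

end

theory Submission
  imports Defs "HOL-Number_Theory.Euler_Criterion"
begin

text \<open>
  Taking all \<open>b\<^sub>i\<close> equal, the upper bound needs \<open>p\<close> of the \<open>p + 2\<close> terms and units \<open>c\<^sub>i\<close> with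
  \<open>\<Sum> c\<^sub>i\<^sup>2 = \<Sum> c\<^sub>i\<^sup>2 x\<^sub>i = 0\<close>. For \<open>p \<ge> 7\<close> a binary form \<open>c\<^sup>2 x + d\<^sup>2 y\<close> with \<open>x, y \<noteq> 0\<close> takes every
  nonzero value at units \<open>c, d\<close>, so a diagonal form in at least three variables takes every value.
  If some residue \<open>v\<close> occurs at least three times, either it occurs \<open>p\<close> times, or one first solves
  \<open>\<Sum> c\<^sub>i\<^sup>2 (x\<^sub>i - v) = 0\<close> on the terms different from \<open>v\<close> and then repairs \<open>\<Sum> c\<^sub>i\<^sup>2 = 0\<close> on the terms
  equal to \<open>v\<close>. Otherwise at least two residues occur exactly twice; the remaining coefficients are
  chosen such that the two equations determine nonzero values of \<open>c\<^sub>1\<^sup>2 + c\<^sub>2\<^sup>2\<close> on each of the two pairs.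
  For \<open>p = 3\<close>, five terms contain three equal ones or all three residues.
  For the lower bound, \<open>1, -n, 0, \<dots>, 0\<close> with \<open>p - 1\<close> zeros and a non-residue \<open>n\<close> has no suitable
  subsequence, already for the first equation.
\<close>

context
  fixes p :: nat
  assumes prime: "prime p" and odd: "odd p"
begin

section \<open>Divisibility by \<open>p\<close>, inverses and non-residues\<close>

lemma p_gt_2: "p > 2"
  using prime odd prime_ge_2_nat[of p] by (cases "p = 2") auto

lemma dvd_mult_iff: "int p dvd x * y \<longleftrightarrow> int p dvd x \<or> int p dvd y"
  using prime by (simp add: prime_dvd_mult_iff)

lemma dvd_power2_iff: "int p dvd x\<^sup>2 \<longleftrightarrow> int p dvd x"
  using dvd_mult_iff by (simp add: power2_eq_square)

lemma not_dvd_small: "0 < x \<Longrightarrow> x < int p \<Longrightarrow> \<not> int p dvd x"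
  by (simp add: zdvd_not_zless)

lemma ex_inverse:
  assumes "\<not> int p dvd x"
  obtains y where "\<not> int p dvd y" "[x * y = 1] (mod int p)"
proof -
  have "coprime x (int p)"
    using assms prime by (metis coprime_commute prime_imp_coprime prime_nat_int_transfer)
  then obtain y where y: "[x * y = 1] (mod int p)"
    using cong_solve_coprime_int by blast
  have "\<not> int p dvd y"
  proof
    assume "int p dvd y"
    then have "int p dvd 1" using cong_dvd_iff[OF y] by simp
    then show False using not_dvd_small[of 1] p_gt_2 by simp
  qed
  with y that show thesis by blast
qed

text \<open>If all these \<open>n\<close> were squares, squaring would map the finite set
  \<open>{0<..<int p}\<close> onto itself and so be injective, yet \<open>1\<close> and
  \<open>int p - 1\<close> have the same square.\<close>

lemma ex_nonresidue: "\<exists>n>0. n < int p \<and> \<not> QuadRes (int p) n"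
proof (rule ccontr)
  assume *: "\<not> ?thesis"
  let ?A = "{0<..<int p}"
  let ?f = "\<lambda>x::int. x\<^sup>2 mod int p"
  have "?A \<subseteq> ?f ` ?A"
  proof
    fix n assume n: "n \<in> ?A"
    with * obtain y where y: "[y\<^sup>2 = n] (mod int p)" by (auto simp: QuadRes_def)
    have "\<not> int p dvd n" using n not_dvd_small by simp
    then have "\<not> int p dvd y" using y dvd_power2_iff cong_dvd_iff by blast
    then have yA: "y mod int p \<in> ?A"
      using p_gt_2 pos_mod_bound[of "int p" y] pos_mod_sign[of "int p" y]
      by (auto simp: dvd_eq_mod_eq_0 order.strict_iff_order)
    have "n = ?f (y mod int p)"
      using y n by (simp add: cong_def power_mod)
    then show "n \<in> ?f ` ?A" using yA by (rule image_eqI)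
  qed
  then have "card ?A \<le> card (?f ` ?A)" by (intro card_mono) auto
  then have "card (?f ` ?A) = card ?A" by (intro antisym card_image_le) auto
  then have "inj_on ?f ?A" by (intro eq_card_imp_inj_on) auto
  moreover have "?f 1 = ?f (int p - 1)"
    by (rule cong_def[THEN iffD1]) (simp add: cong_iff_dvd_diff power2_eq_square algebra_simps)
  ultimately have "1 = int p - 1"
    using p_gt_2 inj_onD[of ?f ?A 1 "int p - 1"] by simp
  then show False using p_gt_2 by simp
qed

section \<open>Square classes modulo \<open>p\<close>\<close>

text \<open>For integers prime to \<open>p\<close> this is equality of cosets of
  \<open>Q_p\<close>.\<close>

definition sq_equiv :: "int \<Rightarrow> int \<Rightarrow> bool"
  where "sq_equiv x y \<longleftrightarrow> (\<exists>c. \<not> int p dvd c \<and> [c\<^sup>2 * x = y] (mod int p))"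

lemma sq_equiv_sym:
  assumes "sq_equiv x y" shows "sq_equiv y x"
proof -
  obtain c where c: "\<not> int p dvd c" "[c\<^sup>2 * x = y] (mod int p)"
    using assms sq_equiv_def by auto
  obtain d where d: "\<not> int p dvd d" "[c * d = 1] (mod int p)"
    using ex_inverse c by blast
  have "[d\<^sup>2 * y = d\<^sup>2 * (c\<^sup>2 * x)] (mod int p)"
    using c by (intro cong_scalar_left) (rule cong_sym)
  also have "d\<^sup>2 * (c\<^sup>2 * x) = (c * d)\<^sup>2 * x" by (simp add: power_mult_distrib)
  also have "[\<dots> = 1\<^sup>2 * x] (mod int p)" using d by (intro cong_scalar_right cong_pow)
  finally show ?thesis unfolding sq_equiv_def using d by auto
qed

text \<open>If \<open>e\<close> is a root of \<open>x * y\<close> and \<open>z\<close> inverts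
  \<open>x\<close>, then \<open>e * z\<close> is a root of the quotient of \<open>y\<close> by
  \<open>x\<close>.\<close>

lemma QuadRes_mult_imp_sq_equiv:
  assumes "\<not> int p dvd x" "\<not> int p dvd y" "QuadRes (int p) (x * y)"
  shows "sq_equiv x y"
proof -
  obtain e where e: "[e\<^sup>2 = x * y] (mod int p)" using assms QuadRes_def by auto
  obtain z where z: "\<not> int p dvd z" "[x * z = 1] (mod int p)" using ex_inverse assms by blast
  have "\<not> int p dvd e" using e assms by (metis cong_dvd_iff dvd_mult_iff dvd_power2_iff)
  then have nz: "\<not> int p dvd e * z" using z dvd_mult_iff by blast
  have "(e * z)\<^sup>2 * x = e\<^sup>2 * (z\<^sup>2 * x)" by (simp add: power_mult_distrib)
  also have "[\<dots> = x * y * (z\<^sup>2 * x)] (mod int p)" using e by (rule cong_scalar_right)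
  also have "x * y * (z\<^sup>2 * x) = (x * z)\<^sup>2 * y" by (simp add: power2_eq_square)
  also have "[\<dots> = 1\<^sup>2 * y] (mod int p)" using z by (intro cong_scalar_right cong_pow)
  finally show ?thesis unfolding sq_equiv_def using nz by auto
qed

text \<open>The unit squares have index two. Were the three pairwise inequivalent,
  \<open>x * y\<close>, \<open>x * z\<close>, \<open>y * z\<close> would be non-residues, each with
  \<open>?h\<close>-th power \<open>-1\<close> by Euler's criterion. The product of these powers is
  \<open>-1\<close>, but it is also \<open>(x * y * z) ^ (p - 1)\<close>, which is
  \<open>1\<close>.\<close>

lemma sq_equiv_two_classes:
  assumes "\<not> int p dvd x" "\<not> int p dvd y" "\<not> int p dvd z"
  shows "sq_equiv x y \<or> sq_equiv x z \<or> sq_equiv y z"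
proof (rule ccontr)
  assume *: "\<not> ?thesis"
  let ?h = "(p - 1) div 2"
  have L: "[- 1 = (u * v) ^ ?h] (mod int p)"
    if "\<not> int p dvd u" "\<not> int p dvd v" "\<not> sq_equiv u v" for u v
  proof -
    have "\<not> QuadRes (int p) (u * v)" using that QuadRes_mult_imp_sq_equiv by blast
    moreover have "\<not> [u * v = 0] (mod int p)"
      using that dvd_mult_iff by (simp add: cong_0_iff)
    ultimately show ?thesis
      using euler_criterion[of p "u * v"] prime p_gt_2 by (simp add: Legendre_def)
  qed
  have "[(- 1) * (- 1) * (- 1) = (x * y) ^ ?h * (x * z) ^ ?h * (y * z) ^ ?h] (mod int p)"
    using * L assms by (intro cong_mult) auto
  also have "(x * y) ^ ?h * (x * z) ^ ?h * (y * z) ^ ?h = ((x * y * z) ^ 2) ^ ?h"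
    by (simp add: power_mult_distrib power2_eq_square)
  also have "\<dots> = (x * y * z) ^ (p - 1)"
    using odd by (simp flip: power_mult)
  also have "[\<dots> = 1] (mod int p)"
  proof -
    have "\<not> int p dvd x * y * z" using assms dvd_mult_iff by blast
    then have "coprime (x * y * z) (int p)"
      using prime by (metis coprime_commute prime_imp_coprime prime_nat_int_transfer)
    then have "[(x * y * z) ^ totient p = 1] (mod int p)"
      using residues.euler_theorem[of "int p"] p_gt_2 by (simp add: residues_def)
    then show ?thesis using prime by (simp add: totient_prime)
  qed
  finally have "int p dvd 2" by (simp add: cong_iff_dvd_diff)
  then show False using p_gt_2 not_dvd_small[of 2] by simp
qed

section \<open>Binary forms evaluated at units\<close>

text \<open>Neither variable may vanish, because weights come from \<open>Q_p\<close>; this makes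
  small primes exceptional.\<close>

definition sq_represents :: "int \<Rightarrow> int \<Rightarrow> int \<Rightarrow> bool"
  where "sq_represents x y t \<longleftrightarrow>
    (\<exists>c d. \<not> int p dvd c \<and> \<not> int p dvd d \<and> [c\<^sup>2 * x + d\<^sup>2 * y = t] (mod int p))"

text \<open>Scaling both variables by a unit multiplies the value by its square, so it suffices to
  represent one value in each square class.\<close>

lemma sq_represents_sq_equiv:
  assumes "sq_represents x y t" "sq_equiv t t'"
  shows "sq_represents x y t'"
proof -
  obtain c d where cd: "\<not> int p dvd c" "\<not> int p dvd d" "[c\<^sup>2 * x + d\<^sup>2 * y = t] (mod int p)"
    using assms sq_represents_def by auto
  obtain e where e: "\<not> int p dvd e" "[e\<^sup>2 * t = t'] (mod int p)"
    using assms sq_equiv_def by auto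
  have "(e * c)\<^sup>2 * x + (e * d)\<^sup>2 * y = e\<^sup>2 * (c\<^sup>2 * x + d\<^sup>2 * y)"
    by (simp add: power_mult_distrib algebra_simps)
  also have "[\<dots> = e\<^sup>2 * t] (mod int p)" using cd by (intro cong_scalar_left)
  also note e(2)
  finally show ?thesis
    unfolding sq_represents_def using cd e dvd_mult_iff by blast
qed

text \<open>The unit linking \<open>z\<close> to \<open>y\<close> is absorbed into the second
  variable: only the square class of a coefficient matters.\<close>

lemma sq_represents_replace:
  assumes "sq_represents x y t" "sq_equiv z y"
  shows "sq_represents x z t"
proof -
  obtain c d where cd: "\<not> int p dvd c" "\<not> int p dvd d" "[c\<^sup>2 * x + d\<^sup>2 * y = t] (mod int p)"
    using assms sq_represents_def by auto
  obtain e where e: "\<not> int p dvd e" "[e\<^sup>2 * z = y] (mod int p)"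
    using assms sq_equiv_def by auto
  have "c\<^sup>2 * x + (d * e)\<^sup>2 * z = c\<^sup>2 * x + d\<^sup>2 * (e\<^sup>2 * z)"
    by (simp add: power_mult_distrib algebra_simps)
  also have "[\<dots> = c\<^sup>2 * x + d\<^sup>2 * y] (mod int p)"
    using e by (intro cong_add cong_scalar_left cong_refl)
  also note cd(3)
  finally show ?thesis
    unfolding sq_represents_def using cd e dvd_mult_iff by blast
qed

lemma sq_represents_same:
  assumes p: "p > 5" and x: "\<not> int p dvd x" and t: "\<not> int p dvd t"
  shows "sq_represents x x t"
proof -
  \<comment> \<open>\<open>p > 5\<close> makes 3, 4 and 5 units. Modulo 3 or 5 the claim fails, as
    no sum of two unit squares is a unit square there.\<close>
  have small: "\<not> int p dvd 1" "\<not> int p dvd 3" "\<not> int p dvd 4" "\<not> int p dvd 5"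
    using p by (auto simp: not_dvd_small)
  \<comment> \<open>\<open>3\<^sup>2 + 4\<^sup>2 = 5\<^sup>2\<close> represents the class of \<open>x\<close>; the other class is represented by
    \<open>m x\<close> for the least non-residue \<open>m\<close>, as \<open>m - 1\<close> is a square.\<close>
  have "sq_represents x x (5\<^sup>2 * x)"
    unfolding sq_represents_def using small by (intro exI[of _ 3] exI[of _ 4]) auto
  moreover have "sq_equiv (5\<^sup>2 * x) x"
    by (rule sq_equiv_sym) (use small in \<open>auto simp: sq_equiv_def\<close>)
  ultimately have rep_x: "sq_represents x x x" using sq_represents_sq_equiv by blast
  define P where "P n \<longleftrightarrow> 0 < n \<and> n < p \<and> \<not> QuadRes (int p) (int n)" for n
  obtain n where "n > 0" "n < int p" "\<not> QuadRes (int p) n" using ex_nonresidue by blast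
  then have "P (nat n)" by (simp add: P_def nat_less_iff)
  define m where "m = (LEAST n. P n)"
  have m: "P m" using \<open>P (nat n)\<close> unfolding m_def by (rule LeastI)
  have min: "\<not> P (m - 1)"
    using m not_less_Least[of "m - 1" P, folded m_def] by (auto simp: P_def)
  have "m \<noteq> 1"
  proof
    assume "m = 1"
    moreover have "QuadRes (int p) 1" unfolding QuadRes_def by (intro exI[of _ 1]) simp
    ultimately show False using m by (simp add: P_def)
  qed
  then have "QuadRes (int p) (int m - 1)"
    using m min by (auto simp: P_def of_nat_diff)
  then obtain f where f: "[f\<^sup>2 = int m - 1] (mod int p)"
    unfolding QuadRes_def by blast
  have "\<not> int p dvd int m - 1"
    using m \<open>m \<noteq> 1\<close> by (intro not_dvd_small) (auto simp: P_def)
  then have nf: "\<not> int p dvd f" using f cong_dvd_iff dvd_power2_iff by blast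
  have "f\<^sup>2 * x + 1\<^sup>2 * x = (f\<^sup>2 + 1) * x" by (simp add: algebra_simps)
  also have "[\<dots> = (int m - 1 + 1) * x] (mod int p)"
    using f by (intro cong_scalar_right cong_add cong_refl)
  also have "(int m - 1 + 1) * x = int m * x" by simp
  finally have rep_m: "sq_represents x x (int m * x)"
    unfolding sq_represents_def using nf small(1) by blast
  have "\<not> sq_equiv x (int m * x)"
  proof
    assume "sq_equiv x (int m * x)"
    then obtain c where "[c\<^sup>2 * x = int m * x] (mod int p)" by (auto simp: sq_equiv_def)
    then have "int p dvd (c\<^sup>2 - int m) * x" by (simp add: cong_iff_dvd_diff algebra_simps)
    then have "[c\<^sup>2 = int m] (mod int p)" using x dvd_mult_iff by (simp add: cong_iff_dvd_diff)
    then show False using m by (auto simp: P_def QuadRes_def)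
  qed
  moreover have "\<not> int p dvd int m * x"
    using m x dvd_mult_iff not_dvd_small[of "int m"] by (auto simp: P_def)
  ultimately have "sq_equiv x t \<or> sq_equiv (int m * x) t"
    using sq_equiv_two_classes x t by blast
  then show ?thesis using rep_x rep_m sq_represents_sq_equiv by blast
qed

text \<open>The squares 1, 4, 9 are distinct modulo \<open>p\<close>, their differences being 3, 8,
  5. Each condition excludes at most one of them, so one of \<open>c = 1, 2, 3\<close> survives
  both.\<close>

lemma ex_square_avoiding:
  assumes p: "p > 5" and y: "\<not> int p dvd y" and z: "\<not> int p dvd z"
  obtains c where "\<not> int p dvd c" "\<not> int p dvd a + c\<^sup>2 * y" "\<not> int p dvd b + c\<^sup>2 * z"
proof -
  have small: "\<not> int p dvd 1" "\<not> int p dvd 2" "\<not> int p dvd 3"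
    "\<not> int p dvd 4" "\<not> int p dvd 5"
    using p by (auto simp: not_dvd_small)
  have eight: "\<not> int p dvd 8"
    using small dvd_mult_iff[of 2 4] by simp
  have diff: "\<not> int p dvd c + d\<^sup>2 * w"
    if "int p dvd c + e\<^sup>2 * w" "\<not> int p dvd w" "\<not> int p dvd d\<^sup>2 - e\<^sup>2" for c d e w
  proof
    assume "int p dvd c + d\<^sup>2 * w"
    then have "int p dvd (c + d\<^sup>2 * w) - (c + e\<^sup>2 * w)" using that by (intro dvd_diff)
    then have "int p dvd (d\<^sup>2 - e\<^sup>2) * w" by (simp add: algebra_simps)
    then show False using that dvd_mult_iff by blast
  qed
  have diffs: "\<not> int p dvd 2\<^sup>2 - 1\<^sup>2" "\<not> int p dvd 3\<^sup>2 - 1\<^sup>2" "\<not> int p dvd 3\<^sup>2 - 2\<^sup>2"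
    using small eight by auto
  have once: "\<not> (int p dvd u + 1\<^sup>2 * w \<and> int p dvd u + 2\<^sup>2 * w)"
    "\<not> (int p dvd u + 1\<^sup>2 * w \<and> int p dvd u + 3\<^sup>2 * w)"
    "\<not> (int p dvd u + 2\<^sup>2 * w \<and> int p dvd u + 3\<^sup>2 * w)"
    if "\<not> int p dvd w" for u w
    using diff[OF _ that diffs(1)] diff[OF _ that diffs(2)] diff[OF _ that diffs(3)] by blast+
  show thesis
    using that[OF small(1)] that[OF small(2)] that[OF small(3)] once[OF y, of a] once[OF z, of b]
    by argo
qed

lemma sq_represents_nonzero:
  assumes p: "p > 5" and x: "\<not> int p dvd x" and y: "\<not> int p dvd y" and t: "\<not> int p dvd t"
  shows "sq_represents x y t"
proof (cases "sq_equiv y x")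
  case True
  then show ?thesis using sq_represents_same[OF p x t] sq_represents_replace by blast
next
  case False
  have small: "\<not> int p dvd 1" using p by (simp add: not_dvd_small)
  \<comment> \<open>This \<open>b\<close> makes \<open>s\<close> below a unit, so that its square
    class can be compared with that of \<open>r * s\<close>.\<close>
  obtain b where b: "\<not> int p dvd b" "\<not> int p dvd x + b\<^sup>2 * y"
    using ex_square_avoiding[OF p y y] by blast
  \<comment> \<open>Multiplying \<open>s = x + b\<^sup>2 y\<close> by the non-residue \<open>r = y / x\<close> gives \<open>r s = y + b\<^sup>2 r\<^sup>2 x\<close>,
    a represented value in the other class.\<close>
  define s where "s = x + b\<^sup>2 * y"
  have rep_s: "sq_represents x y s"
    unfolding sq_represents_def s_def using b small by (intro exI[of _ 1] exI[of _ b]) auto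
  obtain z where z: "\<not> int p dvd z" "[x * z = 1] (mod int p)" using ex_inverse x by blast
  define r where "r = y * z"
  have r: "\<not> int p dvd r" using y z dvd_mult_iff by (simp add: r_def)
  have rx: "[r * x = y] (mod int p)"
    using cong_scalar_right[OF z(2), of y] by (simp add: r_def mult_ac)
  have "(b * r)\<^sup>2 * x + 1\<^sup>2 * y = b\<^sup>2 * r * (r * x) + y"
    by (simp add: power2_eq_square)
  also have "[\<dots> = b\<^sup>2 * r * y + r * x] (mod int p)"
    using rx by (intro cong_add cong_scalar_left cong_sym[OF rx])
  also have "b\<^sup>2 * r * y + r * x = r * s" by (simp add: s_def algebra_simps)
  finally have rep_rs: "sq_represents x y (r * s)"
    unfolding sq_represents_def using b r small dvd_mult_iff by blast
  \<comment> \<open>Cancelling \<open>s\<close> would make \<open>r\<close> a square, and then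
    \<open>y\<close>, congruent to \<open>r * x\<close>, would lie in the class of
    \<open>x\<close>.\<close>
  have "\<not> sq_equiv s (r * s)"
  proof
    assume "sq_equiv s (r * s)"
    then obtain c where c: "\<not> int p dvd c" "[c\<^sup>2 * s = r * s] (mod int p)"
      by (auto simp: sq_equiv_def)
    then have "int p dvd (c\<^sup>2 - r) * s" by (simp add: cong_iff_dvd_diff algebra_simps)
    then have "[c\<^sup>2 = r] (mod int p)"
      using b dvd_mult_iff by (simp add: cong_iff_dvd_diff s_def)
    then have "[c\<^sup>2 * x = r * x] (mod int p)" by (rule cong_scalar_right)
    then have "sq_equiv x y" unfolding sq_equiv_def using c rx cong_trans by blast
    then show False using False sq_equiv_sym by blast
  qed
  moreover have "\<not> int p dvd s" "\<not> int p dvd r * s" using b r dvd_mult_iff by (auto simp: s_def)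
  ultimately have "sq_equiv s t \<or> sq_equiv (r * s) t"
    using sq_equiv_two_classes t by blast
  then show ?thesis using rep_s rep_rs sq_represents_sq_equiv by blast
qed

section \<open>Diagonal forms in three or more variables\<close>

text \<open>All but three variables are set to 1. The third of these is used to make the value left
  for the other two nonzero, whatever \<open>t\<close> is; the binary form then attains it.\<close>

lemma ex_square_combination:
  assumes p: "p > 5" and J: "finite J" "card J \<ge> 3" and y: "\<And>i. i \<in> J \<Longrightarrow> \<not> int p dvd y i"
  obtains c where "\<And>i. i \<in> J \<Longrightarrow> \<not> int p dvd c i" "[(\<Sum>i\<in>J. (c i)\<^sup>2 * y i) = t] (mod int p)"
proof -
  obtain T where T: "T \<subseteq> J" "card T = 3" using obtain_subset_with_card_n[OF J(2)] by blast
  then obtain i j k where ijk: "T = {i, j, k}" "i \<noteq> j" "j \<noteq> k" "i \<noteq> k"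
    by (auto simp: card_3_iff)
  define r where "r = (\<Sum>l\<in>J - T. y l)"
  have nz: "\<not> int p dvd y i" "\<not> int p dvd y j" "\<not> int p dvd y k" using T ijk y by auto
  obtain a where a: "\<not> int p dvd a" "\<not> int p dvd (r - t) + a\<^sup>2 * y k"
    using ex_square_avoiding[OF p nz(3) nz(3)] by blast
  have "\<not> int p dvd - ((r - t) + a\<^sup>2 * y k)" using a by (simp only: dvd_minus_iff) simp
  then obtain c d where cd: "\<not> int p dvd c" "\<not> int p dvd d"
    "[c\<^sup>2 * y i + d\<^sup>2 * y j = - ((r - t) + a\<^sup>2 * y k)] (mod int p)"
    using sq_represents_nonzero[OF p nz(1,2)] unfolding sq_represents_def by blast
  define f where "f = (\<lambda>_. 1)(i := c, j := d, k := a)"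
  have "(\<Sum>l\<in>J. (f l)\<^sup>2 * y l) = (\<Sum>l\<in>J - T. (f l)\<^sup>2 * y l) + (\<Sum>l\<in>T. (f l)\<^sup>2 * y l)"
    using T J by (intro sum.subset_diff) auto
  also have "(\<Sum>l\<in>J - T. (f l)\<^sup>2 * y l) = r"
    unfolding r_def by (intro sum.cong) (auto simp: f_def ijk)
  also have "(\<Sum>l\<in>T. (f l)\<^sup>2 * y l) = c\<^sup>2 * y i + d\<^sup>2 * y j + a\<^sup>2 * y k"
    using ijk by (auto simp: f_def)
  also have "[r + (c\<^sup>2 * y i + d\<^sup>2 * y j + a\<^sup>2 * y k) =
      r + (- ((r - t) + a\<^sup>2 * y k) + a\<^sup>2 * y k)] (mod int p)"
    using cd by (intro cong_add cong_refl)
  also have "r + (- ((r - t) + a\<^sup>2 * y k) + a\<^sup>2 * y k) = t" by simp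
  finally have "[(\<Sum>l\<in>J. (f l)\<^sup>2 * y l) = t] (mod int p)" .
  moreover have "\<not> int p dvd f l" for l
    using cd a p_gt_2 not_dvd_small[of 1] by (auto simp: f_def)
  ultimately show thesis using that by blast
qed

section \<open>Solving both equations on an index set\<close>

text \<open>The squares \<open>(c i)\<^sup>2\<close> stand for the weights \<open>a_i\<close>. A
  constant choice \<open>b\<close> of the \<open>b_i\<close> multiplies the first sum by
  \<open>b\<close>, so this property serves every non-empty \<open>B\<close>.\<close>

definition square_balanced :: "('i \<Rightarrow> int) \<Rightarrow> 'i set \<Rightarrow> bool"
  where "square_balanced x I \<longleftrightarrow> (\<exists>c. (\<forall>i\<in>I. \<not> int p dvd c i) \<and>
    [(\<Sum>i\<in>I. (c i)\<^sup>2) = 0] (mod int p) \<and> [(\<Sum>i\<in>I. (c i)\<^sup>2 * x i) = 0] (mod int p))"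

lemma square_balanced_const:
  assumes "card I = p" "\<And>i. i \<in> I \<Longrightarrow> int p dvd x i - v"
  shows "square_balanced x I"
proof -
  have "[(\<Sum>i\<in>I. x i) = (\<Sum>i\<in>I. v)] (mod int p)"
    using assms by (intro cong_sum) (simp add: cong_iff_dvd_diff)
  then have "[(\<Sum>i\<in>I. x i) = 0] (mod int p)"
    using assms by (simp add: cong_def)
  then show ?thesis
    unfolding square_balanced_def using assms p_gt_2 not_dvd_small[of 1]
    by (intro exI[of _ "\<lambda>_. 1"]) (auto simp: cong_0_iff)
qed

text \<open>Shifting by \<open>v\<close> decouples the equations: the shifted terms vanish on
  \<open>T\<close>, so coefficients on \<open>T\<close> remain free to correct the sum of
  squares.\<close>

lemma square_balanced_large_fibre:
  assumes p: "p > 5" and S: "finite S" "card S = p + 2"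
    and T: "T = {i \<in> S. int p dvd x i - v}" "card T \<ge> 3" "card T < p"
  obtains I where "I \<subseteq> S" "card I = p" "square_balanced x I"
proof -
  have TS: "T \<subseteq> S" "finite T" using T S by (auto intro: finite_subset)
  \<comment> \<open>At least \<open>p + 2 - (p - 1) = 3\<close> indices lie outside the
    fibre.\<close>
  have "card (S - T) \<ge> 3" using S T TS by (simp add: card_Diff_subset)
  then obtain U' where U': "U' \<subseteq> S - T" "card U' = 3" "finite U'"
    using obtain_subset_with_card_n by metis
  obtain T' where T': "T' \<subseteq> T" "card T' = 3" "finite T'"
    using obtain_subset_with_card_n T by metis
  have "card (U' \<union> T') = 6" using U' T' by (subst card_Un_disjoint) auto
  then obtain I where I: "U' \<union> T' \<subseteq> I" "I \<subseteq> S" "card I = p"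
    using exists_subset_between[of "U' \<union> T'" p S] S p U' T' TS by auto
  have fin: "finite I" using I S finite_subset by blast
  have c3: "card (I - T) \<ge> 3" "card (I \<inter> T) \<ge> 3"
    using card_mono[of "I - T" U'] card_mono[of "I \<inter> T" T'] I U' T' fin by auto
  have "\<not> int p dvd x i - v" if "i \<in> I - T" for i using that I T by auto
  then obtain c where c: "\<And>i. i \<in> I - T \<Longrightarrow> \<not> int p dvd c i"
    "[(\<Sum>i\<in>I - T. (c i)\<^sup>2 * (x i - v)) = 0] (mod int p)"
    using ex_square_combination[OF p _ c3(1), of "\<lambda>i. x i - v" 0] fin by blast
  have "\<not> int p dvd 1" using p by (simp add: not_dvd_small)
  then obtain d where d: "\<And>i. i \<in> I \<inter> T \<Longrightarrow> \<not> int p dvd d i"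
    "[(\<Sum>i\<in>I \<inter> T. (d i)\<^sup>2 * 1) = - (\<Sum>i\<in>I - T. (c i)\<^sup>2)] (mod int p)"
    using ex_square_combination[OF p _ c3(2), of "\<lambda>_. 1" "- (\<Sum>i\<in>I - T. (c i)\<^sup>2)"] fin by blast
  define e where "e i = (if i \<in> T then d i else c i)" for i
  have split: "(\<Sum>i\<in>I. (e i)\<^sup>2 * w i) = (\<Sum>i\<in>I - T. (c i)\<^sup>2 * w i) + (\<Sum>i\<in>I \<inter> T. (d i)\<^sup>2 * w i)"
    for w
  proof -
    have "(\<Sum>i\<in>I. (e i)\<^sup>2 * w i) = (\<Sum>i\<in>I - T. (e i)\<^sup>2 * w i) + (\<Sum>i\<in>I \<inter> T. (e i)\<^sup>2 * w i)"
      using fin by (subst sum.union_disjoint[symmetric]) (auto intro: sum.cong)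
    then show ?thesis by (simp add: e_def)
  qed
  have sum1: "int p dvd (\<Sum>i\<in>I. (e i)\<^sup>2)"
    using split[of "\<lambda>_. 1"] d(2) by (simp add: cong_iff_dvd_diff add.commute)
  have "int p dvd (\<Sum>i\<in>I \<inter> T. (d i)\<^sup>2 * (x i - v))"
    using T by (intro dvd_sum) auto
  then have sum2: "int p dvd (\<Sum>i\<in>I. (e i)\<^sup>2 * (x i - v))"
    using split[of "\<lambda>i. x i - v"] c(2) by (simp add: cong_0_iff)
  \<comment> \<open>Undoing the shift adds \<open>v\<close> times the sum of squares, already zero
    modulo \<open>p\<close>.\<close>
  have "(\<Sum>i\<in>I. (e i)\<^sup>2 * x i) = (\<Sum>i\<in>I. (e i)\<^sup>2 * (x i - v)) + v * (\<Sum>i\<in>I. (e i)\<^sup>2)"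
    by (simp add: sum_distrib_left algebra_simps flip: sum.distrib)
  then have "int p dvd (\<Sum>i\<in>I. (e i)\<^sup>2 * x i)" using sum1 sum2 by simp
  moreover have "\<not> int p dvd e i" if "i \<in> I" for i using that c d by (auto simp: e_def)
  ultimately have "square_balanced x I"
    unfolding square_balanced_def using sum1 by (auto simp: cong_0_iff)
  then show thesis using that I by blast
qed

lemma ex_same_residue:
  assumes "finite S" "card S > p"
  obtains i j where "i \<in> S" "j \<in> S" "i \<noteq> j" "int p dvd x j - x i"
proof -
  have "(\<lambda>i. x i mod int p) ` S \<subseteq> {0..<int p}" using p_gt_2 by auto
  then have "card ((\<lambda>i. x i mod int p) ` S) \<le> p"
    using card_mono[of "{0..<int p}"] by fastforce
  then have "\<not> inj_on (\<lambda>i. x i mod int p) S"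
    using assms pigeonhole by (metis card_image not_less)
  then show thesis
    using that by (auto simp: inj_on_def mod_eq_dvd_iff)
qed

text \<open>With the other coefficients fixed, the sums \<open>c\<^sup>2 + c'\<^sup>2\<close> and
  \<open>d\<^sup>2 + d'\<^sup>2\<close> on the two pairs solve a linear system with determinant
  \<open>x j - x i\<close>, a unit. Binary forms attain only nonzero values reliably, so a fifth
  index \<open>r\<close> is used to make both solutions nonzero.\<close>

lemma square_balanced_small_fibres:
  assumes p: "p > 5" and S: "finite S" "card S = p + 2"
    and fib: "\<And>v. card {i \<in> S. int p dvd x i - v} < 3"
  obtains I where "I \<subseteq> S" "card I = p" "square_balanced x I"
proof -
  have no_triple: False
    if "{i, j, k} \<subseteq> S" "i \<noteq> j" "j \<noteq> k" "i \<noteq> k" "int p dvd x j - x i" "int p dvd x k - x i"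
    for i j k
  proof -
    have "card {i, j, k} \<le> card {l \<in> S. int p dvd x l - x i}"
      using that S by (intro card_mono) auto
    then show False using that fib[of "x i"] by auto
  qed
  obtain i i' where i: "i \<in> S" "i' \<in> S" "i \<noteq> i'" "int p dvd x i' - x i"
    using S by (elim ex_same_residue[of S]) auto
  \<comment> \<open>Without \<open>i\<close> there are still \<open>p + 1\<close> indices, enough
    for a second collision.\<close>
  obtain j j' where j: "j \<in> S - {i}" "j' \<in> S - {i}" "j \<noteq> j'" "int p dvd x j' - x j"
    using S i(1) by (elim ex_same_residue[of "S - {i}" x, rotated 2]) auto
  have ij: "\<not> int p dvd x j - x i"
  proof
    assume *: "int p dvd x j - x i"
    then have "int p dvd (x j' - x j) + (x j - x i)" using j by (intro dvd_add)
    then show False using no_triple[of i j j'] * i j by auto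
  qed
  have "i' \<noteq> j" using ij i by auto
  moreover have "i' \<noteq> j'"
  proof
    assume "i' = j'"
    then show False using ij dvd_diff[OF i(4) j(4)] by simp
  qed
  ultimately have dist: "i \<noteq> i'" "i \<noteq> j" "i \<noteq> j'" "i' \<noteq> j" "i' \<noteq> j'" "j \<noteq> j'"
    using i j by auto
  define D where "D = {i, i', j, j'}"
  have D: "D \<subseteq> S" "card D = 4" "finite D" using i j dist by (auto simp: D_def)
  then obtain I where I: "D \<subseteq> I" "I \<subseteq> S" "card I = p"
    using exists_subset_between[of D p S] S p by auto
  define R where "R = I - D"
  have fin: "finite I" "finite R" using finite_subset[OF I(2) S(1)] by (auto simp: R_def)
  have "card R = p - 4" using I D by (simp add: R_def card_Diff_subset)
  then obtain r where r: "r \<in> R" using p by fastforce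
  have rS: "r \<in> S" "r \<noteq> i" "r \<noteq> i'" "r \<noteq> j" "r \<noteq> j'" using r I by (auto simp: R_def D_def)
  have ri: "\<not> int p dvd x r - x i" using no_triple[of i i' r] rS i by auto
  have rj: "\<not> int p dvd x r - x j" using no_triple[of j j' r] rS j by auto
  define P where "P = (\<Sum>k\<in>R - {r}. x k - x i)"
  define Q where "Q = (\<Sum>k\<in>R - {r}. x k - x j)"
  \<comment> \<open>One \<open>a\<close> must keep both constants \<open>P'\<close> and
    \<open>Q'\<close> of the linear system nonzero.\<close>
  obtain a where a: "\<not> int p dvd a" "\<not> int p dvd P + a\<^sup>2 * (x r - x i)"
      "\<not> int p dvd Q + a\<^sup>2 * (x r - x j)"
    using ex_square_avoiding[OF p ri rj] by blast
  define P' where "P' = P + a\<^sup>2 * (x r - x i)"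
  define Q' where "Q' = Q + a\<^sup>2 * (x r - x j)"
  obtain w where w: "\<not> int p dvd w" "[(x j - x i) * w = 1] (mod int p)"
    using ex_inverse ij by blast
  have small: "\<not> int p dvd 1" using p by (simp add: not_dvd_small)
  \<comment> \<open>Shifting by \<open>x j\<close> removes the second pair and forces
    \<open>Q' * w\<close> on the first; shifting by \<open>x i\<close> likewise forces
    \<open>- (P' * w)\<close> on the second.\<close>
  have "\<not> int p dvd Q' * w" using a w dvd_mult_iff by (auto simp: Q'_def)
  then obtain c c' where c: "\<not> int p dvd c" "\<not> int p dvd c'" "[c\<^sup>2 * 1 + c'\<^sup>2 * 1 = Q' * w] (mod int p)"
    using sq_represents_nonzero[OF p small small] unfolding sq_represents_def by blast
  have "\<not> int p dvd - (P' * w)" using a w dvd_mult_iff by (auto simp: P'_def)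
  then obtain d d' where d: "\<not> int p dvd d" "\<not> int p dvd d'" "[d\<^sup>2 * 1 + d'\<^sup>2 * 1 = - (P' * w)] (mod int p)"
    using sq_represents_nonzero[OF p small small] unfolding sq_represents_def by blast
  define e where "e = (\<lambda>_. 1)(i := c, i' := c', j := d, j' := d', r := a)"
  have split: "(\<Sum>k\<in>I. (e k)\<^sup>2 * y k) = (\<Sum>k\<in>R - {r}. y k) + a\<^sup>2 * y r
      + (c\<^sup>2 * y i + c'\<^sup>2 * y i' + d\<^sup>2 * y j + d'\<^sup>2 * y j')" for y
  proof -
    have "(\<Sum>k\<in>I. (e k)\<^sup>2 * y k) = (\<Sum>k\<in>R. (e k)\<^sup>2 * y k) + (\<Sum>k\<in>D. (e k)\<^sup>2 * y k)"
      unfolding R_def using I fin by (intro sum.subset_diff) auto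
    also have "(\<Sum>k\<in>R. (e k)\<^sup>2 * y k) = (e r)\<^sup>2 * y r + (\<Sum>k\<in>R - {r}. (e k)\<^sup>2 * y k)"
      using fin r by (intro sum.remove)
    also have "(\<Sum>k\<in>R - {r}. (e k)\<^sup>2 * y k) = (\<Sum>k\<in>R - {r}. y k)"
      by (intro sum.cong) (auto simp: e_def R_def D_def)
    also have "(\<Sum>k\<in>D. (e k)\<^sup>2 * y k) = c\<^sup>2 * y i + c'\<^sup>2 * y i' + d\<^sup>2 * y j + d'\<^sup>2 * y j'"
      using dist rS by (simp add: e_def D_def)
    finally show ?thesis by (simp add: e_def)
  qed
  define E where "E = (\<Sum>k\<in>I. (e k)\<^sup>2)"
  define F where "F = (\<Sum>k\<in>I. (e k)\<^sup>2 * x k)"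
  have shift: "(\<Sum>k\<in>I. (e k)\<^sup>2 * (x k - v)) = F - v * E" for v
    by (simp add: E_def F_def sum_distrib_left algebra_simps flip: sum_subtractf)
  \<comment> \<open>Explicit multiples of \<open>p\<close> turn the congruences into equations, so
    the rest is polynomial identities.\<close>
  obtain q where q: "x i' - x i = int p * q" using i by blast
  obtain q' where q': "x j' - x j = int p * q'" using j by blast
  obtain k1 where k1: "(x j - x i) * w = 1 + int p * k1"
    using w by (metis cong_iff_lin cong_sym)
  obtain k2 where k2: "c\<^sup>2 + c'\<^sup>2 = Q' * w + int p * k2"
    using c by (metis cong_iff_lin cong_sym mult.right_neutral)
  obtain k3 where k3: "d\<^sup>2 + d'\<^sup>2 = - (P' * w) + int p * k3"
    using d by (metis cong_iff_lin cong_sym mult.right_neutral)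
  have "F - x i * E = P' + (c'\<^sup>2 * (x i' - x i) + d\<^sup>2 * (x j - x i) + d'\<^sup>2 * (x j' - x i))"
    using split[of "\<lambda>k. x k - x i"] shift[of "x i"] by (simp add: P'_def P_def)
  also have "\<dots> = P' + c'\<^sup>2 * (int p * q) + (d\<^sup>2 + d'\<^sup>2) * (x j - x i) + d'\<^sup>2 * (int p * q')"
    unfolding q[symmetric] q'[symmetric] by (simp add: algebra_simps)
  also have "\<dots> = P' - P' * ((x j - x i) * w)
      + int p * (c'\<^sup>2 * q + k3 * (x j - x i) + d'\<^sup>2 * q')"
    unfolding k3 by (simp add: algebra_simps)
  also have "\<dots> = int p * (c'\<^sup>2 * q + k3 * (x j - x i) + d'\<^sup>2 * q' - P' * k1)"
    unfolding k1 by (simp add: algebra_simps)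
  finally have Fi: "int p dvd F - x i * E" by simp
  have "F - x j * E = Q' + (c\<^sup>2 * (x i - x j) + c'\<^sup>2 * (x i' - x j) + d'\<^sup>2 * (x j' - x j))"
    using split[of "\<lambda>k. x k - x j"] shift[of "x j"] by (simp add: Q'_def Q_def)
  also have "\<dots> = Q' + c'\<^sup>2 * (int p * q) - (c\<^sup>2 + c'\<^sup>2) * (x j - x i) + d'\<^sup>2 * (int p * q')"
    unfolding q[symmetric] q'[symmetric] by (simp add: algebra_simps)
  also have "\<dots> = Q' - Q' * ((x j - x i) * w)
      + int p * (c'\<^sup>2 * q - k2 * (x j - x i) + d'\<^sup>2 * q')"
    unfolding k2 by (simp add: algebra_simps)
  also have "\<dots> = int p * (c'\<^sup>2 * q - k2 * (x j - x i) + d'\<^sup>2 * q' - Q' * k1)"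
    unfolding k1 by (simp add: algebra_simps)
  finally have Fj: "int p dvd F - x j * E" by simp
  \<comment> \<open>The difference is \<open>(x j - x i) * E\<close>, which isolates the sum of
    squares \<open>E\<close>.\<close>
  have "int p dvd (F - x i * E) - (F - x j * E)" using Fi Fj by (rule dvd_diff)
  then have "int p dvd (x j - x i) * E" by (simp add: algebra_simps)
  then have E: "int p dvd E" using ij dvd_mult_iff by blast
  then have "int p dvd (F - x i * E) + x i * E" using Fi by (intro dvd_add) auto
  then have F: "int p dvd F" by simp
  have "\<not> int p dvd e k" for k using a c d small by (auto simp: e_def)
  then have "square_balanced x I"
    unfolding square_balanced_def using E F by (auto simp: cong_0_iff E_def F_def)
  then show thesis using that I by blast
qed

text \<open>Five indices in fibres of size at most two meet all three residues; with weights 1 both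
  sums vanish modulo 3.\<close>

lemma square_balanced_mod_3:
  assumes p: "p = 3" and S: "finite S" "card S = p + 2"
    and fib: "\<And>v. card {i \<in> S. int p dvd x i - v} < 3"
  obtains I where "I \<subseteq> S" "card I = p" "square_balanced x I"
proof -
  let ?F = "\<lambda>v. {i \<in> S. int p dvd x i - v}"
  have "S \<subseteq> ?F 0 \<union> ?F 1 \<union> ?F 2"
  proof
    fix i assume "i \<in> S"
    moreover have "3 dvd x i \<or> 3 dvd x i - 1 \<or> 3 dvd x i - 2" by presburger
    ultimately show "i \<in> ?F 0 \<union> ?F 1 \<union> ?F 2" using p by auto
  qed
  then have "card S \<le> card (?F 0 \<union> ?F 1 \<union> ?F 2)" using S by (intro card_mono) auto
  also have "\<dots> \<le> card (?F 0) + card (?F 1) + card (?F 2)"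
    by (meson add_le_mono1 card_Un_le le_trans)
  finally have sum: "5 \<le> card (?F 0) + card (?F 1) + card (?F 2)" using S p by simp
  have "card (?F 0) \<noteq> 0" "card (?F 1) \<noteq> 0" "card (?F 2) \<noteq> 0"
    using sum fib[of 0] fib[of 1] fib[of 2] by linarith+
  then have "?F 0 \<noteq> {}" "?F 1 \<noteq> {}" "?F 2 \<noteq> {}" by (metis card.empty)+
  then obtain i j k where ijk: "i \<in> ?F 0" "j \<in> ?F 1" "k \<in> ?F 2" by blast
  have dist: "i \<noteq> j" "j \<noteq> k" "i \<noteq> k"
    using ijk p by (auto, presburger+)
  have "3 dvd x i + (x j + x k)"
    using ijk p by (auto, presburger)
  then have "square_balanced x {i, j, k}"
    unfolding square_balanced_def using p dist
    by (intro exI[of _ "\<lambda>_. 1"]) (auto simp: cong_0_iff)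
  then show thesis using that[of "{i, j, k}"] dist ijk p by auto
qed

lemma ex_square_balanced:
  assumes p: "p \<noteq> 5" and S: "finite S" "card S = p + 2"
  obtains I where "I \<subseteq> S" "card I = p" "square_balanced x I"
proof -
  have p_cases: "p = 3 \<or> p > 5"
  proof -
    have "p \<noteq> 4" using odd by auto
    then show ?thesis using p p_gt_2 by linarith
  qed
  show thesis
  proof (cases "\<exists>v. card {i \<in> S. int p dvd x i - v} \<ge> 3")
    case True
    then obtain v where v: "card {i \<in> S. int p dvd x i - v} \<ge> 3" by blast
    show thesis
    proof (cases "card {i \<in> S. int p dvd x i - v} \<ge> p")
      case True
      then obtain I where "I \<subseteq> {i \<in> S. int p dvd x i - v}" "card I = p"
        using obtain_subset_with_card_n by metis
      then show thesis using that square_balanced_const[of I x v] by blast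
    next
      case False
      \<comment> \<open>For \<open>p = 3\<close> a fibre of three elements would already have size
        \<open>p\<close>.\<close>
      then have "p > 5" using v p_cases by auto
      then show thesis using square_balanced_large_fibre[OF _ S refl v] False that by auto
    qed
  next
    case False
    then have "card {i \<in> S. int p dvd x i - v} < 3" for v using not_less by blast
    then show thesis
      using p_cases square_balanced_mod_3[OF _ S] square_balanced_small_fibres[OF _ S] that
      by blast
  qed
qed

section \<open>From residue rings to integers, and the upper bound\<close>

lemma weighted_zero_sum_iff:
  "weighted_zero_sum p A B xs \<longleftrightarrow>
    (\<exists>as bs. length as = length xs \<and> set as \<subseteq> A \<and> length bs = length xs \<and> set bs \<subseteq> B \<and>
      int p dvd (\<Sum>i<length xs. as ! i * xs ! i) \<and> int p dvd (\<Sum>i<length xs. bs ! i * as ! i))"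
proof -
  interpret residues "int p" "Zmod p" using p_gt_2 by unfold_locales auto
  have "(\<Oplus>\<^bsub>Zmod p\<^esub>i\<in>{..<n}. f i \<otimes>\<^bsub>Zmod p\<^esub> g i) = \<zero>\<^bsub>Zmod p\<^esub> \<longleftrightarrow>
      int p dvd (\<Sum>i<n. f i * g i)" for n :: nat and f g
    by (simp add: res_mult_eq sum_cong zero_cong dvd_eq_mod_eq_0)
  then show ?thesis unfolding weighted_zero_sum_def by simp
qed

lemma unit_squares_iff:
  "a \<in> unit_squares p \<longleftrightarrow> (\<exists>c. \<not> int p dvd c \<and> a = c\<^sup>2 mod int p)"
proof -
  interpret residues_prime p "Zmod p" using prime by unfold_locales
  have pow: "x [^]\<^bsub>Zmod p\<^esub> (2::nat) = x\<^sup>2 mod int p" if "x \<in> Units (Zmod p)" for x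
  proof -
    have "x mod int p = x" using that by (auto simp: res_units_eq)
    then show ?thesis using pow_cong[of x 2] by simp
  qed
  show ?thesis
  proof
    assume "a \<in> unit_squares p"
    then obtain x where x: "x \<in> Units (Zmod p)" "a = x [^]\<^bsub>Zmod p\<^esub> (2::nat)"
      unfolding unit_squares_def by blast
    moreover have "\<not> int p dvd x" using x(1) by (simp add: res_units_eq not_dvd_small)
    ultimately show "\<exists>c. \<not> int p dvd c \<and> a = c\<^sup>2 mod int p" using pow by blast
  next
    assume "\<exists>c. \<not> int p dvd c \<and> a = c\<^sup>2 mod int p"
    then obtain c where c: "\<not> int p dvd c" "a = c\<^sup>2 mod int p" by blast
    have "c mod int p \<in> Units (Zmod p)"
      using c m_gt_one by (intro mod_in_res_units) (auto simp: p_coprime_right_int)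
    moreover have "a = (c mod int p) [^]\<^bsub>Zmod p\<^esub> (2::nat)"
      using c pow_cong[of c 2] by simp
    ultimately show "a \<in> unit_squares p" unfolding unit_squares_def by blast
  qed
qed

lemma ex_weighted_zero_sum_subseq:
  assumes p: "p \<noteq> 5" and B: "b \<in> B" and xs: "length xs = p + 2"
  obtains ys where "subseq ys xs" "length ys = p" "weighted_zero_sum p (unit_squares p) B ys"
proof -
  obtain I where I: "I \<subseteq> {..<length xs}" "card I = p" "square_balanced ((!) xs) I"
    using ex_square_balanced[OF p, of "{..<length xs}" "(!) xs"] xs by auto
  obtain c where c: "\<And>i. i \<in> I \<Longrightarrow> \<not> int p dvd c i"
    "int p dvd (\<Sum>i\<in>I. (c i)\<^sup>2)" "int p dvd (\<Sum>i\<in>I. (c i)\<^sup>2 * xs ! i)"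
    using I(3) unfolding square_balanced_def cong_0_iff by blast
  \<comment> \<open>Filtering the increasing list of positions preserves order, so the selected
    terms form a subsequence.\<close>
  define L where "L = filter (\<lambda>i. i \<in> I) [0..<length xs]"
  have L: "set L = I" "distinct L" using I by (auto simp: L_def)
  then have len: "length L = p" using I distinct_card by metis
  have sum_L: "(\<Sum>i<length L. f (L ! i)) = (\<Sum>i\<in>I. f i)" for f :: "nat \<Rightarrow> int"
    using L by (simp add: sum_list_sum_nth sum.distinct_set_conv_list atLeast0LessThan flip: L(1))
  define ys where "ys = map ((!) xs) L"
  define as where "as = map (\<lambda>i. (c i)\<^sup>2 mod int p) L"
  define bs where "bs = replicate p b"
  have "subseq ys (map ((!) xs) [0..<length xs])"
    unfolding ys_def L_def by (intro subseq_map subseq_filter_left)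
  then have "subseq ys xs" by (simp add: map_nth)
  moreover have "length ys = p" using len by (simp add: ys_def)
  moreover have "weighted_zero_sum p (unit_squares p) B ys"
  proof -
    have "(c i)\<^sup>2 mod int p \<in> unit_squares p" if "i \<in> I" for i
      using c(1)[OF that] unit_squares_iff by blast
    then have "set as \<subseteq> unit_squares p" using L by (auto simp: as_def)
    moreover have "int p dvd (\<Sum>i<length ys. as ! i * ys ! i)"
    proof -
      have "(\<Sum>i<length ys. as ! i * ys ! i) = (\<Sum>i<length L. (c (L ! i))\<^sup>2 mod int p * xs ! (L ! i))"
        by (simp add: as_def ys_def)
      also have "\<dots> = (\<Sum>i\<in>I. (c i)\<^sup>2 mod int p * xs ! i)" by (rule sum_L)
      also have "[\<dots> = (\<Sum>i\<in>I. (c i)\<^sup>2 * xs ! i)] (mod int p)"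
        by (intro cong_sum cong_scalar_right) (simp add: cong_def)
      finally show ?thesis using c(3) cong_dvd_iff by blast
    qed
    moreover have "int p dvd (\<Sum>i<length ys. bs ! i * as ! i)"
    proof -
      have "(\<Sum>i<length ys. bs ! i * as ! i) = (\<Sum>i<length L. b * ((c (L ! i))\<^sup>2 mod int p))"
        using len by (simp add: as_def bs_def ys_def)
      also have "\<dots> = (\<Sum>i\<in>I. b * ((c i)\<^sup>2 mod int p))" by (rule sum_L)
      also have "[\<dots> = (\<Sum>i\<in>I. b * (c i)\<^sup>2)] (mod int p)"
        by (intro cong_sum cong_scalar_left) (simp add: cong_def)
      also have "(\<Sum>i\<in>I. b * (c i)\<^sup>2) = b * (\<Sum>i\<in>I. (c i)\<^sup>2)" by (simp add: sum_distrib_left)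
      finally show ?thesis using c(2) cong_dvd_iff dvd_mult by blast
    qed
    moreover have "length as = length ys" "length bs = length ys" "set bs \<subseteq> B"
      using B len by (auto simp: as_def bs_def ys_def)
    ultimately show ?thesis unfolding weighted_zero_sum_iff by blast
  qed
  ultimately show thesis using that by blast
qed

section \<open>The lower bound\<close>

lemma subseq_replicateD: "subseq zs (replicate n a) \<Longrightarrow> zs = replicate (length zs) a"
  by (intro replicate_eqI) (auto simp: subseq_conv_nths dest: in_set_nthsD)

text \<open>With only \<open>p - 1\<close> zeros, \<open>ys\<close> contains \<open>1\<close> or
  \<open>m\<close>. A single nonzero term keeps a nonzero weighted sum; if both occur, a zero sum
  makes \<open>- m\<close> a quotient of unit squares.\<close>

lemma no_weighted_zero_sum_subseq:
  assumes m: "0 \<le> m" "m < int p" "\<not> QuadRes (int p) (- m)"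
    and ys: "subseq ys (1 # m # replicate (p - 1) 0)" "length ys = p"
  shows "\<not> weighted_zero_sum p (unit_squares p) B ys"
proof
  assume "weighted_zero_sum p (unit_squares p) B ys"
  then obtain as where as: "length as = length ys" "set as \<subseteq> unit_squares p"
    "int p dvd (\<Sum>i<length ys. as ! i * ys ! i)"
    unfolding weighted_zero_sum_iff by blast
  have nm: "\<not> int p dvd m"
  proof
    assume "int p dvd m"
    then have "[0\<^sup>2 = - m] (mod int p)" by (simp add: cong_iff_dvd_diff)
    then show False using m(3) unfolding QuadRes_def by blast
  qed
  have unit: "\<not> int p dvd a" if a: "a \<in> set as" for a
  proof -
    have "a \<in> unit_squares p" using a as by blast
    then obtain c where "\<not> int p dvd c" "a = c\<^sup>2 mod int p" using unit_squares_iff by blast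
    then show ?thesis using dvd_power2_iff by (simp add: dvd_mod_iff)
  qed
  have zero: "(\<Sum>i<n. f i * replicate n 0 ! i) = (0::int)" for f n by (intro sum.neutral) simp
  have pos: "p > 0" using p_gt_2 by simp
  consider n where "ys = replicate n 0" "n \<le> p - 1"
    | n where "ys = m # replicate n 0" | n where "ys = 1 # replicate n 0"
    | n where "ys = 1 # m # replicate n 0"
  proof -
    have step: "(\<exists>us. ys = u # us \<and> subseq us vs) \<or> subseq ys vs"
      if "subseq ys (u # vs)" for ys vs and u :: int
      using that by (cases rule: list_emb.cases) auto
    have rep: "us = replicate (length us) 0 \<and> length us \<le> p - 1"
      if "subseq us (replicate (p - 1) 0)" for us :: "int list"
      using that subseq_replicateD[OF that] list_emb_length[OF that] by simp
    show thesis
      using step[OF ys(1)] step rep that by metis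
  qed
  then show False
  proof cases
    case 1
    then show False using ys(2) pos by simp
  next
    case (2 n)
    then obtain a as' where a: "as = a # as'" using as(1) by (cases as) auto
    have "int p dvd a * m" using as(3) 2 a zero by (simp add: sum.lessThan_Suc_shift del: sum.lessThan_Suc)
    then show False using unit[of a] a nm dvd_mult_iff by simp
  next
    case (3 n)
    then obtain a as' where a: "as = a # as'" using as(1) by (cases as) auto
    have "int p dvd a" using as(3) 3 a zero by (simp add: sum.lessThan_Suc_shift del: sum.lessThan_Suc)
    then show False using unit[of a] a by simp
  next
    case (4 n)
    then obtain a a' as' where a: "as = a # a' # as'"
      using as(1) by (cases as; cases "tl as") auto
    have *: "int p dvd a + a' * m"
      using as(3) 4 a zero by (simp add: sum.lessThan_Suc_shift del: sum.lessThan_Suc)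
    have "a \<in> unit_squares p" "a' \<in> unit_squares p" using as(2) a by auto
    then obtain c d where cd: "a = c\<^sup>2 mod int p" "\<not> int p dvd d" "a' = d\<^sup>2 mod int p"
      unfolding unit_squares_iff by blast
    obtain e where e: "[d * e = 1] (mod int p)" using ex_inverse cd by blast
    have "[c\<^sup>2 + d\<^sup>2 * m = a + a' * m] (mod int p)"
      unfolding cd by (intro cong_add cong_scalar_right) (auto simp: cong_def)
    then have "int p dvd c\<^sup>2 + d\<^sup>2 * m" using * cong_dvd_iff by blast
    then have "[c\<^sup>2 = - (d\<^sup>2 * m)] (mod int p)" by (simp add: cong_iff_dvd_diff)
    \<comment> \<open>Multiplying by \<open>e\<^sup>2\<close> divides by \<open>d\<^sup>2\<close>
      and exhibits \<open>e * c\<close> as a root of \<open>- m\<close>.\<close>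
    then have "[e\<^sup>2 * c\<^sup>2 = e\<^sup>2 * - (d\<^sup>2 * m)] (mod int p)" by (rule cong_scalar_left)
    also have "e\<^sup>2 * - (d\<^sup>2 * m) = (d * e)\<^sup>2 * - m" by (simp add: power_mult_distrib)
    also have "[\<dots> = 1\<^sup>2 * - m] (mod int p)" using e by (intro cong_scalar_right cong_pow)
    finally have "[(e * c)\<^sup>2 = - m] (mod int p)" by (simp add: power_mult_distrib)
    then show False using m(3) unfolding QuadRes_def by blast
  qed
qed

end

theorem theorem5p1:
  fixes p :: nat and B :: "int set"
  assumes "prime p" and "odd p" and "p \<noteq> 5"
    and "B \<subseteq> carrier (Zmod p)" and "B \<noteq> {}"
  shows "E_const p (unit_squares p) B = p + 2"
  unfolding E_const_def
proof (rule Least_equality)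
  obtain b where "b \<in> B" using assms by blast
  then show "0 < p + 2 \<and> (\<forall>xs. set xs \<subseteq> carrier (Zmod p) \<and> length xs = p + 2 \<longrightarrow>
      (\<exists>ys. subseq ys xs \<and> length ys = p \<and> weighted_zero_sum p (unit_squares p) B ys))"
    using ex_weighted_zero_sum_subseq[OF assms(1-3)] by (metis add_gr_0 zero_less_numeral)
next
  fix k
  assume k: "0 < k \<and> (\<forall>xs. set xs \<subseteq> carrier (Zmod p) \<and> length xs = k \<longrightarrow>
      (\<exists>ys. subseq ys xs \<and> length ys = p \<and> weighted_zero_sum p (unit_squares p) B ys))"
  obtain n where n: "0 < n" "n < int p" "\<not> QuadRes (int p) n"
    using ex_nonresidue[OF assms(1,2)] by blast
  \<comment> \<open>The representative of \<open>- n\<close> in the carrier.\<close>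
  define m where "m = int p - n"
  have m: "0 \<le> m" "m < int p" using n by (auto simp: m_def)
  have "[- m = n] (mod int p)" by (simp add: m_def cong_iff_dvd_diff)
  then have nr: "\<not> QuadRes (int p) (- m)" using n(3) unfolding QuadRes_def using cong_trans by blast
  define ws where "ws = 1 # m # replicate (p - 1) 0"
  have p: "p > 2" using p_gt_2[OF assms(1,2)] .
  show "p + 2 \<le> k"
  proof (rule ccontr)
    assume "\<not> p + 2 \<le> k"
    \<comment> \<open>\<open>ws\<close> has length \<open>p + 1\<close>, so its prefixes give
      counterexamples for every smaller \<open>k\<close> as well.\<close>
    then have "length (take k ws) = k" using p by (simp add: ws_def)
    moreover have "set (take k ws) \<subseteq> carrier (Zmod p)"
      using set_take_subset[of k ws] m p by (auto simp: ws_def residue_ring_def)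
    ultimately obtain ys where ys: "subseq ys (take k ws)" "length ys = p"
      "weighted_zero_sum p (unit_squares p) B ys"
      using k by blast
    have "subseq (take k ws) ws" by (intro prefix_imp_subseq take_is_prefix)
    then have "subseq ys ws" using ys(1) subseq_order.trans by blast
    then show False
      using no_weighted_zero_sum_subseq[OF assms(1,2) m nr _ ys(2)] ys(3) by (simp add: ws_def)
  qed
qed

end
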